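(* Let $n\ge 1$ be an odd integer, let $f$ be a smooth real-valued function of one real variable, and let $I\subset\mathbb{R}$ be an interval such that $f^{(n+1)}(t)\neq 0$ for all $t\in I$. For $t\in I$ let $g_t$ be the osculating (Taylor) polynomial of degree $n$ of $f$ at $t$. Let $a<b$ be two points of $I$. Then the graphs of $g_a$ and $g_b$ are disjoint over $[b,\infty)$, i.e. $g_a(x)\neq g_b(x)$ for all $x\in[b,\infty)$.
   Context: The osculating (Taylor) polynomial of degree $n$ of $f$ at the point $t$ is $$g_t(x)=\sum_{i=0}^n \frac{f^{(i)}(t)}{i!}(x-t)^i ,\qquad x\in\mathbb{R},$$ i.e. the polynomial whose value and first $n$ derivatives at $t$ coincide with those of $f$. *)

theory Defs
  imports "HOL-Analysis.Analysis"
begin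

(* Intended for open U: the differential quotients behind deriv are two-sided, so an
   iterated derivative at a point of U is meaningful only if f is smooth near that point. *)
definition smooth_on :: "real set \<Rightarrow> (real \<Rightarrow> real) \<Rightarrow> bool" where
  "smooth_on U f \<longleftrightarrow> (\<forall>k. \<forall>x\<in>U. (deriv ^^ k) f differentiable (at x))"

definition osculating_poly :: "nat \<Rightarrow> (real \<Rightarrow> real) \<Rightarrow> real \<Rightarrow> real \<Rightarrow> real" where
  "osculating_poly n f t x = (\<Sum>i=0..n. (deriv ^^ i) f t / fact i * (x - t) ^ i)"

end

theory Submission imports Defs begin

text \<open>
  Fix \<open>x\<close> and regard the value \<open>g\<^sub>t(x)\<close> of the osculating polynomial as a function of its base
  point \<open>t\<close>. Differentiating the defining sum in \<open>t\<close> gives a telescoping sum, of which only the last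
  contribution survives:
  \<open>\<partial>/\<partial>t g\<^sub>t(x) = f\<^sup>(\<^sup>n\<^sup>+\<^sup>1\<^sup>)(t) / n! * (x - t)\<^sup>n\<close>
  (lemma \<open>osculating_poly_has_derivative_base\<close>).
  By the mean value theorem, \<open>g\<^sub>b(x) - g\<^sub>a(x)\<close> is \<open>b - a\<close> times this derivative at some \<open>t\<close> strictly
  between \<open>a\<close> and \<open>b\<close>. For \<open>x \<ge> b\<close> we have \<open>x - t > 0\<close>, and \<open>f\<^sup>(\<^sup>n\<^sup>+\<^sup>1\<^sup>)(t) \<noteq> 0\<close> because
  \<open>t\<close> lies in the interval \<open>I\<close>; hence the difference is nonzero.
\<close>

lemma smooth_on_has_derivative_funpow_deriv:
  assumes "smooth_on U f" and "t \<in> U"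
  shows "((deriv ^^ k) f has_real_derivative (deriv ^^ Suc k) f t) (at t)"
proof -
  have "(deriv ^^ k) f differentiable (at t)"
    using assms by (simp add: smooth_on_def)
  then show ?thesis
    by (simp add: DERIV_deriv_iff_real_differentiable)
qed

lemma osculating_poly_has_derivative_base:
  assumes "smooth_on U f" and "t \<in> U"
  shows "((\<lambda>s. osculating_poly n f s x) has_real_derivative
           (deriv ^^ Suc n) f t / fact n * (x - t) ^ n) (at t)"
proof (induction n)
  case 0
  then show ?case
    using smooth_on_has_derivative_funpow_deriv[OF assms, of 0]
    by (simp add: osculating_poly_def)
next
  case (Suc n)
  let ?D = "\<lambda>k. (deriv ^^ k) f"
  have pow: "((\<lambda>s. (x - s) ^ Suc n) has_real_derivative - (real (Suc n) * (x - t) ^ n)) (at t)"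
    by (rule derivative_eq_intros refl | simp)+
  have "((\<lambda>s. ?D (Suc n) s / fact (Suc n) * (x - s) ^ Suc n) has_real_derivative
          ?D (Suc (Suc n)) t / fact (Suc n) * (x - t) ^ Suc n
          + - (real (Suc n) * (x - t) ^ n) * (?D (Suc n) t / fact (Suc n))) (at t)"
    by (rule DERIV_mult[OF DERIV_cdivide[OF smooth_on_has_derivative_funpow_deriv[OF assms]] pow])
  from DERIV_add[OF Suc.IH this]
  have "((\<lambda>s. osculating_poly (Suc n) f s x) has_real_derivative
          ?D (Suc n) t / fact n * (x - t) ^ n
          + (?D (Suc (Suc n)) t / fact (Suc n) * (x - t) ^ Suc n
             + - (real (Suc n) * (x - t) ^ n) * (?D (Suc n) t / fact (Suc n)))) (at t)"
    by (simp only: osculating_poly_def sum.atLeast0_atMost_Suc)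
  moreover have "real (Suc n) * (?D (Suc n) t / fact (Suc n)) = ?D (Suc n) t / fact n"
    by (simp del: funpow.simps add: fact_Suc)
  then have "- (real (Suc n) * (x - t) ^ n) * (?D (Suc n) t / fact (Suc n))
      = - (?D (Suc n) t / fact n * (x - t) ^ n)"
    by (metis (no_types, opaque_lifting) mult.assoc mult.commute mult_minus_left)
  ultimately show ?case
    by simp
qed

theorem theorem2:
  fixes f :: "real \<Rightarrow> real" and n :: nat and U I :: "real set" and a b :: real
  assumes "n \<ge> 1" and "odd n"
    and "open U" and "smooth_on U f"
    and "is_interval I" and "I \<subseteq> U"
    and "\<And>t. t \<in> I \<Longrightarrow> (deriv ^^ (n + 1)) f t \<noteq> 0"
    and "a \<in> I" and "b \<in> I" and "a < b"
  shows "\<forall>x\<in>{b..}. osculating_poly n f a x \<noteq> osculating_poly n f b x"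
proof
  fix x assume "x \<in> {b..}"
  then have "b \<le> x" by simp
  have I: "t \<in> I" if "a \<le> t" "t \<le> b" for t
    using mem_is_interval_1_I[OF \<open>is_interval I\<close> \<open>a \<in> I\<close> \<open>b \<in> I\<close>] that .
  have "((\<lambda>s. osculating_poly n f s x) has_real_derivative
          (deriv ^^ Suc n) f t / fact n * (x - t) ^ n) (at t)" if "a \<le> t" "t \<le> b" for t
    using I[OF that] \<open>I \<subseteq> U\<close> \<open>smooth_on U f\<close>
    by (intro osculating_poly_has_derivative_base[where U = U]) auto
  from MVT2[OF \<open>a < b\<close> this] obtain t where t: "a < t" "t < b"
    and eq: "osculating_poly n f b x - osculating_poly n f a x
      = (b - a) * ((deriv ^^ Suc n) f t / fact n * (x - t) ^ n)"
    by blast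
  have "(deriv ^^ Suc n) f t \<noteq> 0"
    using assms(7)[OF I, of t] t by simp
  moreover have "x - t > 0"
    using t \<open>b \<le> x\<close> by simp
  ultimately have "(b - a) * ((deriv ^^ Suc n) f t / fact n * (x - t) ^ n) \<noteq> 0"
    using \<open>a < b\<close> by simp
  with eq show "osculating_poly n f a x \<noteq> osculating_poly n f b x"
    by (metis diff_self)
qed

end
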